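(* Let $\mathbf{P}$ be an additive category with biased weak pullbacks, and let $\overline{\alpha}: (A \xrightarrow{\gamma_A} \Omega_A \xleftarrow{\rho_A} R_A) \to (B \xrightarrow{\gamma_B} \Omega_B \xleftarrow{\rho_B} R_B)$ be a morphism in $\mathcal{Q}(\mathbf{P})$. Let $(P, \pi, u)$ with $P = P(\alpha\cdot\gamma_B, \rho_B)$ and $\pi = \pi(\alpha\cdot\gamma_B, \rho_B): P \to A$ be a biased weak pullback of the cospan $A \xrightarrow{\alpha\cdot\gamma_B} \Omega_B \xleftarrow{\rho_B} R_B$. Then $\pi$ defines a well-defined morphism in $\mathcal{Q}(\mathbf{P})$ $$\overline{\pi}: (P \xrightarrow{\pi\cdot\gamma_A} \Omega_A \xleftarrow{\rho_A} R_A) \longrightarrow (A \xrightarrow{\gamma_A} \Omega_A \xleftarrow{\rho_A} R_A)$$ which is a kernel embedding of $\overline{\alpha}$. Moreover, for every morphism $\overline{\tau}: (T \xrightarrow{\gamma_T} \Omega_T \xleftarrow{\rho_T} R_T) \to (A \xrightarrow{\gamma_A} \Omega_A \xleftarrow{\rho_A} R_A)$ in $\mathcal{Q}(\mathbf{P})$ with $\overline{\tau}\cdot\overline{\alpha} = 0$, the unique morphism $(T \xrightarrow{\gamma_T} \Omega_T \xleftarrow{\rho_T} R_T) \to (P \xrightarrow{\pi\cdot\gamma_A} \Omega_A \xleftarrow{\rho_A} R_A)$ induced by the universal property of the kernel is represented by $u(\tau): T \to P$.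
   Context: Composition is written diagrammatically: for $\alpha: A \to B$ and $\beta: B \to C$, the composite is $\alpha\cdot\beta: A \to C$. A cospan in $\mathbf{P}$ is a pair of morphisms $(A \xrightarrow{\gamma} B \xleftarrow{\rho} C)$ with common codomain. $\mathrm{Syz}(A \xrightarrow{\gamma} B \xleftarrow{\rho} C)$ is the full subcategory of the slice category of $\mathbf{P}$ over $A$ whose objects, called syzygies, are the morphisms $\sigma: S \to A$ for which there exists $\omega: S \to C$ (a syzygy witness) with $\sigma\cdot\gamma = \omega\cdot\rho$. The additive category $\mathrm{Aux}(\mathbf{P})$ has as objects the cospans $(A \xrightarrow{\gamma_A} \Omega_A \xleftarrow{\rho_A} R_A)$ in $\mathbf{P}$; a morphism from $(A \xrightarrow{\gamma_A} \Omega_A \xleftarrow{\rho_A} R_A)$ to $(B \xrightarrow{\gamma_B} \Omega_B \xleftarrow{\rho_B} R_B)$ is a morphism $\alpha: A \to B$ in $\mathbf{P}$ satisfying the well-definedness property: $\sigma \in \mathrm{Syz}(A \xrightarrow{\gamma_A} \Omega_A \xleftarrow{\rho_A} R_A)$ implies $\sigma\cdot\alpha \in \mathrm{Syz}(B \xrightarrow{\gamma_B} \Omega_B \xleftarrow{\rho_B} R_B)$; composition and identities are those of $\mathbf{P}$. The ideal $\mathbf{I}(\mathbf{P})$ of $\mathrm{Aux}(\mathbf{P})$ consists of the morphisms $\alpha$ (notation as before) for which there exists $\zeta: A \to R_B$ with $\alpha\cdot\gamma_B = \zeta\cdot\rho_B$. $\mathcal{Q}(\mathbf{P}) := \mathrm{Aux}(\mathbf{P})/\mathbf{I}(\mathbf{P})$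 is the additive quotient category; the class of a morphism $\alpha$ of $\mathrm{Aux}(\mathbf{P})$ is denoted $\overline{\alpha}$. A biased weak pullback of a cospan $A \xrightarrow{\alpha} B \xleftarrow{\gamma} C$ consists of: an object $P(\alpha,\gamma)$; a morphism $\pi(\alpha,\gamma): P(\alpha,\gamma) \to A$ (the biased weak pullback projection) for which there exists $\omega: P(\alpha,\gamma) \to C$ with $\omega\cdot\gamma = \pi(\alpha,\gamma)\cdot\alpha$; and an operation $u$ assigning to each $\tau: T \to A$ such that $\exists \sigma: T \to C$ with $\tau\cdot\alpha = \sigma\cdot\gamma$ a morphism $u(\tau): T \to P(\alpha,\gamma)$ with $\tau = u(\tau)\cdot\pi(\alpha,\gamma)$ (no uniqueness, and no compatibility with $\omega$ and $\sigma$, is required). $\mathbf{P}$ has biased weak pullbacks if it comes equipped with an operation constructing such a triple for every cospan. *)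

theory Defs
  imports "HOL-Algebra.Coset"
begin

text \<open>
  Hom-sets are indexed by pairs of objects and are not required to be disjoint, so that one
  morphism of a category may represent morphisms between many different objects of a category
  built from it. Therefore all operations on morphisms carry the objects as arguments:
  \<open>Cmp C A B D f g\<close> is the diagrammatic composite of \<open>f : A \<rightarrow> B\<close> and \<open>g : B \<rightarrow> D\<close>.
\<close>

record ('o, 'm) cat =
  Obj :: "'o set"
  Hom :: "'o \<Rightarrow> 'o \<Rightarrow> 'm set"
  Idm :: "'o \<Rightarrow> 'm"
  Cmp :: "'o \<Rightarrow> 'o \<Rightarrow> 'o \<Rightarrow> 'm \<Rightarrow> 'm \<Rightarrow> 'm"

record ('o, 'm) abcat = "('o, 'm) cat" +
  Zm :: "'o \<Rightarrow> 'o \<Rightarrow> 'm"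
  Plus :: "'o \<Rightarrow> 'o \<Rightarrow> 'm \<Rightarrow> 'm \<Rightarrow> 'm"

text \<open>
  HOL-Algebra's groups without a ring structure are multiplicative, so \<open>\<otimes>\<close>, \<open>Mod\<close> and \<open>#>\<close>
  for a \<open>hom_group\<close> refer to the addition of morphisms.
\<close>

definition hom_group :: "('o, 'm, 'z) abcat_scheme \<Rightarrow> 'o \<Rightarrow> 'o \<Rightarrow> 'm monoid" where
  "hom_group C A B = \<lparr>carrier = Hom C A B, mult = Plus C A B, one = Zm C A B\<rparr>"

locale category =
  fixes C :: "('o, 'm, 'z) cat_scheme"
  assumes Idm_in: "A \<in> Obj C \<Longrightarrow> Idm C A \<in> Hom C A A"
    and Cmp_in: "\<lbrakk>A \<in> Obj C; B \<in> Obj C; D \<in> Obj C; f \<in> Hom C A B; g \<in> Hom C B D\<rbrakk>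
      \<Longrightarrow> Cmp C A B D f g \<in> Hom C A D"
    and Idm_left: "\<lbrakk>A \<in> Obj C; B \<in> Obj C; f \<in> Hom C A B\<rbrakk> \<Longrightarrow> Cmp C A A B (Idm C A) f = f"
    and Idm_right: "\<lbrakk>A \<in> Obj C; B \<in> Obj C; f \<in> Hom C A B\<rbrakk> \<Longrightarrow> Cmp C A B B f (Idm C B) = f"
    and Cmp_assoc: "\<lbrakk>A \<in> Obj C; B \<in> Obj C; D \<in> Obj C; E \<in> Obj C;
        f \<in> Hom C A B; g \<in> Hom C B D; h \<in> Hom C D E\<rbrakk>
      \<Longrightarrow> Cmp C A D E (Cmp C A B D f g) h = Cmp C A B E f (Cmp C B D E g h)"

locale preadditive_category = category C
  for C :: "('o, 'm, 'z) abcat_scheme" +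
  assumes hom_comm_group: "\<lbrakk>A \<in> Obj C; B \<in> Obj C\<rbrakk> \<Longrightarrow> comm_group (hom_group C A B)"
    and Cmp_Plus_left: "\<lbrakk>A \<in> Obj C; B \<in> Obj C; D \<in> Obj C;
        f \<in> Hom C A B; f' \<in> Hom C A B; g \<in> Hom C B D\<rbrakk>
      \<Longrightarrow> Cmp C A B D (Plus C A B f f') g = Plus C A D (Cmp C A B D f g) (Cmp C A B D f' g)"
    and Cmp_Plus_right: "\<lbrakk>A \<in> Obj C; B \<in> Obj C; D \<in> Obj C;
        f \<in> Hom C A B; g \<in> Hom C B D; g' \<in> Hom C B D\<rbrakk>
      \<Longrightarrow> Cmp C A B D f (Plus C B D g g') = Plus C A D (Cmp C A B D f g) (Cmp C A B D f g')"

definition zero_object :: "('o, 'm, 'z) cat_scheme \<Rightarrow> 'o \<Rightarrow> bool" where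
  "zero_object C Z \<longleftrightarrow> Z \<in> Obj C \<and>
     (\<forall>A \<in> Obj C. (\<exists>!f. f \<in> Hom C A Z) \<and> (\<exists>!f. f \<in> Hom C Z A))"

definition direct_sum ::
  "('o, 'm, 'z) abcat_scheme \<Rightarrow> 'o \<Rightarrow> 'o \<Rightarrow> 'o \<Rightarrow> 'm \<Rightarrow> 'm \<Rightarrow> 'm \<Rightarrow> 'm \<Rightarrow> bool" where
  "direct_sum C A B S i1 i2 p1 p2 \<longleftrightarrow> S \<in> Obj C \<and>
     i1 \<in> Hom C A S \<and> i2 \<in> Hom C B S \<and> p1 \<in> Hom C S A \<and> p2 \<in> Hom C S B \<and>
     Cmp C A S A i1 p1 = Idm C A \<and> Cmp C B S B i2 p2 = Idm C B \<and>
     Cmp C A S B i1 p2 = Zm C A B \<and> Cmp C B S A i2 p1 = Zm C B A \<and>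
     Plus C S S (Cmp C S A S p1 i1) (Cmp C S B S p2 i2) = Idm C S"

locale additive_category = preadditive_category C
  for C :: "('o, 'm, 'z) abcat_scheme" +
  assumes ex_zero_object: "\<exists>Z. zero_object C Z"
    and ex_direct_sum: "\<lbrakk>A \<in> Obj C; B \<in> Obj C\<rbrakk>
      \<Longrightarrow> \<exists>S i1 i2 p1 p2. direct_sum C A B S i1 i2 p1 p2"

definition is_kernel ::
  "('o, 'm, 'z) abcat_scheme \<Rightarrow> 'o \<Rightarrow> 'o \<Rightarrow> 'm \<Rightarrow> 'o \<Rightarrow> 'm \<Rightarrow> bool" where
  "is_kernel C A B f K k \<longleftrightarrow> K \<in> Obj C \<and> k \<in> Hom C K A \<and> Cmp C K A B k f = Zm C K B \<and>
     (\<forall>T \<in> Obj C. \<forall>t \<in> Hom C T A. Cmp C T A B t f = Zm C T B \<longrightarrow>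
        (\<exists>!v. v \<in> Hom C T K \<and> Cmp C T K A v k = t))"

definition kernel_lift ::
  "('o, 'm, 'z) cat_scheme \<Rightarrow> 'o \<Rightarrow> 'o \<Rightarrow> 'm \<Rightarrow> 'o \<Rightarrow> 'm \<Rightarrow> 'm" where
  "kernel_lift C A K k T t = (THE v. v \<in> Hom C T K \<and> Cmp C T K A v k = t)"

definition slice :: "('o, 'm, 'z) cat_scheme \<Rightarrow> 'o \<Rightarrow> ('o \<times> 'm, 'm) cat" where
  "slice C A = \<lparr>
     Obj = {(S, \<sigma>). S \<in> Obj C \<and> \<sigma> \<in> Hom C S A},
     Hom = (\<lambda>(S, \<sigma>) (T, \<tau>). {f \<in> Hom C S T. Cmp C S T A f \<tau> = \<sigma>}),
     Idm = (\<lambda>(S, \<sigma>). Idm C S),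
     Cmp = (\<lambda>(S, \<sigma>) (T, \<tau>) (U, \<upsilon>). Cmp C S T U)\<rparr>"

definition full_subcat :: "('o, 'm) cat \<Rightarrow> 'o set \<Rightarrow> ('o, 'm) cat" where
  "full_subcat C X = C\<lparr>Obj := Obj C \<inter> X\<rparr>"

text \<open>The record \<open>\<lparr>A, \<Omega>, R, \<gamma>, \<rho>\<rparr>\<close> stands for the cospan of \<open>\<gamma> : A \<rightarrow> \<Omega>\<close> and \<open>\<rho> : R \<rightarrow> \<Omega>\<close>.\<close>

record ('o, 'm) cospan =
  lsrc :: 'o
  apex :: 'o
  rsrc :: 'o
  lleg :: 'm
  rleg :: 'm

definition cospans :: "('o, 'm, 'z) cat_scheme \<Rightarrow> ('o, 'm) cospan set" where
  "cospans C = {X. lsrc X \<in> Obj C \<and> apex X \<in> Obj C \<and> rsrc X \<in> Obj C \<and>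
     lleg X \<in> Hom C (lsrc X) (apex X) \<and> rleg X \<in> Hom C (rsrc X) (apex X)}"

definition Syz :: "('o, 'm, 'z) cat_scheme \<Rightarrow> ('o, 'm) cospan \<Rightarrow> ('o \<times> 'm, 'm) cat" where
  "Syz C X = full_subcat (slice C (lsrc X))
     {(S, \<sigma>). \<exists>\<omega> \<in> Hom C S (rsrc X).
        Cmp C S (lsrc X) (apex X) \<sigma> (lleg X) = Cmp C S (rsrc X) (apex X) \<omega> (rleg X)}"

definition Aux :: "('o, 'm, 'z) abcat_scheme \<Rightarrow> (('o, 'm) cospan, 'm) abcat" where
  "Aux C = \<lparr>
     Obj = cospans C,
     Hom = (\<lambda>X Y. {\<alpha> \<in> Hom C (lsrc X) (lsrc Y).
       \<forall>S \<sigma>. (S, \<sigma>) \<in> Obj (Syz C X) \<longrightarrow>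
         (S, Cmp C S (lsrc X) (lsrc Y) \<sigma> \<alpha>) \<in> Obj (Syz C Y)}),
     Idm = (\<lambda>X. Idm C (lsrc X)),
     Cmp = (\<lambda>X Y Z. Cmp C (lsrc X) (lsrc Y) (lsrc Z)),
     Zm = (\<lambda>X Y. Zm C (lsrc X) (lsrc Y)),
     Plus = (\<lambda>X Y. Plus C (lsrc X) (lsrc Y))\<rparr>"

definition Aux_ideal ::
  "('o, 'm, 'z) abcat_scheme \<Rightarrow> ('o, 'm) cospan \<Rightarrow> ('o, 'm) cospan \<Rightarrow> 'm set" where
  "Aux_ideal C X Y = {\<alpha> \<in> Hom (Aux C) X Y. \<exists>\<zeta> \<in> Hom C (lsrc X) (rsrc Y).
     Cmp C (lsrc X) (lsrc Y) (apex Y) \<alpha> (lleg Y) = Cmp C (lsrc X) (rsrc Y) (apex Y) \<zeta> (rleg Y)}"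

definition residue_class ::
  "('o, 'm, 'z) abcat_scheme \<Rightarrow> ('o \<Rightarrow> 'o \<Rightarrow> 'm set) \<Rightarrow> 'o \<Rightarrow> 'o \<Rightarrow> 'm \<Rightarrow> 'm set" where
  "residue_class C I A B f = I A B #>\<^bsub>hom_group C A B\<^esub> f"

text \<open>
  For an ideal \<open>I\<close>, the classes joined in the definition of \<open>Cmp\<close> below are all equal, namely to
  the class of the composite of any two representatives.
\<close>

definition quotient_cat ::
  "('o, 'm, 'z) abcat_scheme \<Rightarrow> ('o \<Rightarrow> 'o \<Rightarrow> 'm set) \<Rightarrow> ('o, 'm set) abcat" where
  "quotient_cat C I = \<lparr>
     Obj = Obj C,
     Hom = (\<lambda>A B. carrier (hom_group C A B Mod I A B)),
     Idm = (\<lambda>A. residue_class C I A A (Idm C A)),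
     Cmp = (\<lambda>A B D F G. \<Union>f\<in>F. \<Union>g\<in>G. residue_class C I A D (Cmp C A B D f g)),
     Zm = (\<lambda>A B. one (hom_group C A B Mod I A B)),
     Plus = (\<lambda>A B. mult (hom_group C A B Mod I A B))\<rparr>"

definition QCat :: "('o, 'm, 'z) abcat_scheme \<Rightarrow> (('o, 'm) cospan, 'm set) abcat" where
  "QCat C = quotient_cat (Aux C) (Aux_ideal C)"

definition QClass ::
  "('o, 'm, 'z) abcat_scheme \<Rightarrow> ('o, 'm) cospan \<Rightarrow> ('o, 'm) cospan \<Rightarrow> 'm \<Rightarrow> 'm set" where
  "QClass C X Y \<alpha> = residue_class (Aux C) (Aux_ideal C) X Y \<alpha>"

text \<open>The operation \<open>bw_univ\<close> takes the source \<open>T\<close> of \<open>\<tau> : T \<rightarrow> A\<close> as an explicit argument.\<close>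

record ('o, 'm) bw_pullback =
  bw_obj :: 'o
  bw_proj :: 'm
  bw_univ :: "'o \<Rightarrow> 'm \<Rightarrow> 'm"

definition biased_weak_pullback ::
  "('o, 'm, 'z) cat_scheme \<Rightarrow> ('o, 'm) cospan \<Rightarrow> ('o, 'm) bw_pullback \<Rightarrow> bool" where
  "biased_weak_pullback C X W \<longleftrightarrow>
     bw_obj W \<in> Obj C \<and> bw_proj W \<in> Hom C (bw_obj W) (lsrc X) \<and>
     (\<exists>\<omega> \<in> Hom C (bw_obj W) (rsrc X).
        Cmp C (bw_obj W) (rsrc X) (apex X) \<omega> (rleg X) =
        Cmp C (bw_obj W) (lsrc X) (apex X) (bw_proj W) (lleg X)) \<and>
     (\<forall>T \<in> Obj C. \<forall>\<tau> \<in> Hom C T (lsrc X).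
        (\<exists>\<sigma> \<in> Hom C T (rsrc X).
           Cmp C T (lsrc X) (apex X) \<tau> (lleg X) = Cmp C T (rsrc X) (apex X) \<sigma> (rleg X)) \<longrightarrow>
        bw_univ W T \<tau> \<in> Hom C T (bw_obj W) \<and>
        \<tau> = Cmp C T (bw_obj W) (lsrc X) (bw_univ W T \<tau>) (bw_proj W))"

definition has_biased_weak_pullbacks ::
  "('o, 'm, 'z) cat_scheme \<Rightarrow> (('o, 'm) cospan \<Rightarrow> ('o, 'm) bw_pullback) \<Rightarrow> bool" where
  "has_biased_weak_pullbacks C bwp \<longleftrightarrow> (\<forall>X \<in> cospans C. biased_weak_pullback C X (bwp X))"

end

theory Submission
  imports Defs
begin

text \<open>
  A morphism of \<open>Aux\<close> vanishes in the quotient iff it is itself a syzygy of its target cospan.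
  Hence \<open>\<tau> \<cdot> \<alpha>\<close> vanishes iff \<open>\<tau>\<close> satisfies the condition under which \<open>u(\<tau>)\<close> exists, so \<open>\<pi>\<close>
  is a weak kernel. Uniqueness of the lifts is forced by the choice \<open>\<pi> \<cdot> \<gamma>\<^sub>A\<close> for the left leg of
  the source of \<open>\<pi>\<close>: a morphism \<open>v\<close> to that source vanishes iff \<open>v \<cdot> \<pi>\<close> does.
\<close>

subsection \<open>Quotients of preadditive categories by ideals\<close>

lemma hom_group_simps [simp]:
  "carrier (hom_group C A B) = Hom C A B"
  "mult (hom_group C A B) = Plus C A B"
  "one (hom_group C A B) = Zm C A B"
  by (simp_all add: hom_group_def)

section \<open>Additivity of composition in each argument\<close>

context preadditive_category
begin

lemma hom_is_group: "\<lbrakk>A \<in> Obj C; B \<in> Obj C\<rbrakk> \<Longrightarrow> group (hom_group C A B)"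
  using hom_comm_group comm_group.axioms(2) by blast

lemma inv_hom_closed: "\<lbrakk>A \<in> Obj C; B \<in> Obj C; f \<in> Hom C A B\<rbrakk> \<Longrightarrow> inv\<^bsub>hom_group C A B\<^esub> f \<in> Hom C A B"
  using group.inv_closed[OF hom_is_group] by fastforce

text \<open>Distributivity in the form of a \<open>group_hom\<close>, so that compatibility with
  zero and negatives follows from general facts on group homomorphisms.\<close>

lemma group_hom_Cmp_left:
  assumes "A \<in> Obj C" "B \<in> Obj C" "D \<in> Obj C" "g \<in> Hom C B D"
  shows "group_hom (hom_group C A B) (hom_group C A D) (\<lambda>f. Cmp C A B D f g)"
  using assms
  by (intro group_hom.intro group_hom_axioms.intro hom_is_group homI)
    (auto simp: Cmp_in Cmp_Plus_left)

lemma group_hom_Cmp_right: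
  assumes "A \<in> Obj C" "B \<in> Obj C" "D \<in> Obj C" "f \<in> Hom C A B"
  shows "group_hom (hom_group C B D) (hom_group C A D) (Cmp C A B D f)"
  using assms
  by (intro group_hom.intro group_hom_axioms.intro hom_is_group homI)
    (auto simp: Cmp_in Cmp_Plus_right)

lemma Cmp_Zm_left:
  "\<lbrakk>A \<in> Obj C; B \<in> Obj C; D \<in> Obj C; g \<in> Hom C B D\<rbrakk> \<Longrightarrow> Cmp C A B D (Zm C A B) g = Zm C A D"
  using group_hom.hom_one[OF group_hom_Cmp_left] by fastforce

lemma Cmp_Zm_right:
  "\<lbrakk>A \<in> Obj C; B \<in> Obj C; D \<in> Obj C; f \<in> Hom C A B\<rbrakk> \<Longrightarrow> Cmp C A B D f (Zm C B D) = Zm C A D"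
  using group_hom.hom_one[OF group_hom_Cmp_right] by fastforce

lemma Cmp_inv_left:
  "\<lbrakk>A \<in> Obj C; B \<in> Obj C; D \<in> Obj C; f \<in> Hom C A B; g \<in> Hom C B D\<rbrakk>
   \<Longrightarrow> Cmp C A B D (inv\<^bsub>hom_group C A B\<^esub> f) g = inv\<^bsub>hom_group C A D\<^esub> (Cmp C A B D f g)"
  using group_hom.hom_inv[OF group_hom_Cmp_left] by fastforce

lemma Cmp_inv_right:
  "\<lbrakk>A \<in> Obj C; B \<in> Obj C; D \<in> Obj C; f \<in> Hom C A B; g \<in> Hom C B D\<rbrakk>
   \<Longrightarrow> Cmp C A B D f (inv\<^bsub>hom_group C B D\<^esub> g) = inv\<^bsub>hom_group C A D\<^esub> (Cmp C A B D f g)"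
  using group_hom.hom_inv[OF group_hom_Cmp_right] by fastforce

end

section \<open>Two-sided ideals and calculation with residue classes\<close>

locale preadditive_ideal = preadditive_category C
  for C :: "('o, 'm, 'z) abcat_scheme" +
  fixes I :: "'o \<Rightarrow> 'o \<Rightarrow> 'm set"
  assumes subgroup_ideal: "\<lbrakk>A \<in> Obj C; B \<in> Obj C\<rbrakk> \<Longrightarrow> subgroup (I A B) (hom_group C A B)"
    and ideal_Cmp_left: "\<lbrakk>A \<in> Obj C; B \<in> Obj C; D \<in> Obj C; f \<in> Hom C A B; g \<in> I B D\<rbrakk>
      \<Longrightarrow> Cmp C A B D f g \<in> I A D"
    and ideal_Cmp_right: "\<lbrakk>A \<in> Obj C; B \<in> Obj C; D \<in> Obj C; f \<in> I A B; g \<in> Hom C B D\<rbrakk>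
      \<Longrightarrow> Cmp C A B D f g \<in> I A D"
begin

abbreviation Q where "Q \<equiv> quotient_cat C I"
abbreviation cls where "cls \<equiv> residue_class C I"

lemma ideal_sub: "\<lbrakk>A \<in> Obj C; B \<in> Obj C\<rbrakk> \<Longrightarrow> I A B \<subseteq> Hom C A B"
  using subgroup.subset[OF subgroup_ideal] by fastforce

lemma Obj_quotient [simp]: "Obj Q = Obj C"
  by (simp add: quotient_cat_def)

lemma Hom_quotient: "Hom Q A B = cls A B ` Hom C A B"
  by (auto simp: quotient_cat_def residue_class_def FactGroup_def RCOSETS_def)

lemma Zm_quotient: "Zm Q A B = I A B"
  by (simp add: quotient_cat_def)

text \<open>Cosets partition the hom-group, so the classes agree iff \<open>f\<close> lies in the
  class of \<open>g\<close>; \<open>rcos_module\<close> turns this into a condition on the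
  difference.\<close>

lemma class_eq_iff:
  assumes "A \<in> Obj C" "B \<in> Obj C" "f \<in> Hom C A B" "g \<in> Hom C A B"
  shows "cls A B f = cls A B g \<longleftrightarrow> Plus C A B f (inv\<^bsub>hom_group C A B\<^esub> g) \<in> I A B"
proof -
  interpret G: group "hom_group C A B" by (rule hom_is_group[OF assms(1,2)])
  note sub = subgroup_ideal[OF assms(1,2)]
  have "cls A B f = cls A B g \<longleftrightarrow> f \<in> cls A B g"
    using G.rcos_self[OF _ sub, of f] G.repr_independence[OF _ _ sub, of f g] assms
    by (auto simp: residue_class_def)
  also have "\<dots> \<longleftrightarrow> Plus C A B f (inv\<^bsub>hom_group C A B\<^esub> g) \<in> I A B"
    using subgroup.rcos_module[OF sub G.is_group, of g f] assms
    by (simp add: residue_class_def)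
  finally show ?thesis .
qed

lemma class_eq_Zm_iff:
  assumes "A \<in> Obj C" "B \<in> Obj C" "f \<in> Hom C A B"
  shows "cls A B f = Zm Q A B \<longleftrightarrow> f \<in> I A B"
proof -
  interpret G: group "hom_group C A B" by (rule hom_is_group[OF assms(1,2)])
  note sub = subgroup_ideal[OF assms(1,2)]
  show ?thesis
    using G.rcos_self[OF _ sub, of f] G.coset_join2[OF _ sub, of f] assms
    by (auto simp: residue_class_def Zm_quotient)
qed

text \<open>Serves to exchange representatives in the union that defines composition of
  classes.\<close>

lemma class_mem_iff:
  assumes "A \<in> Obj C" "B \<in> Obj C" "f \<in> Hom C A B"
  shows "f' \<in> cls A B f \<longleftrightarrow> f' \<in> Hom C A B \<and> cls A B f' = cls A B f"
proof -
  interpret G: group "hom_group C A B" by (rule hom_is_group[OF assms(1,2)])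
  note sub = subgroup_ideal[OF assms(1,2)]
  have "cls A B f \<subseteq> Hom C A B"
    using G.r_coset_subset_G[of "I A B" f] ideal_sub assms by (auto simp: residue_class_def)
  then show ?thesis
    using G.rcos_self[OF _ sub, of f'] G.repr_independence[OF _ _ sub, of f' f] assms
    by (auto simp: residue_class_def)
qed

text \<open>One factor is changed at a time: \<open>(f' - f) g'\<close> lies in the ideal by
  \<open>ideal_Cmp_right\<close>, and \<open>f (g' - g)\<close> by
  \<open>ideal_Cmp_left\<close>.\<close>

lemma class_Cmp_cong:
  assumes obj: "A \<in> Obj C" "B \<in> Obj C" "D \<in> Obj C"
    and hom: "f \<in> Hom C A B" "f' \<in> Hom C A B" "g \<in> Hom C B D" "g' \<in> Hom C B D"
    and eq: "cls A B f' = cls A B f" "cls B D g' = cls B D g"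
  shows "cls A D (Cmp C A B D f' g') = cls A D (Cmp C A B D f g)"
proof -
  have "cls A D (Cmp C A B D f' g') = cls A D (Cmp C A B D f g')"
    using ideal_Cmp_right[of A B D "Plus C A B f' (inv\<^bsub>hom_group C A B\<^esub> f)" g'] assms
    by (simp add: class_eq_iff Cmp_in Cmp_Plus_left Cmp_inv_left inv_hom_closed)
  also have "\<dots> = cls A D (Cmp C A B D f g)"
    using ideal_Cmp_left[of A B D f "Plus C B D g' (inv\<^bsub>hom_group C B D\<^esub> g)"] assms
    by (simp add: class_eq_iff Cmp_in Cmp_Plus_right Cmp_inv_right inv_hom_closed)
  finally show ?thesis .
qed

lemma Cmp_class:
  assumes "A \<in> Obj C" "B \<in> Obj C" "D \<in> Obj C" "f \<in> Hom C A B" "g \<in> Hom C B D"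
  shows "Cmp Q A B D (cls A B f) (cls B D g) = cls A D (Cmp C A B D f g)"
proof -
  have cong: "cls A D (Cmp C A B D f' g') = cls A D (Cmp C A B D f g)"
    if "f' \<in> cls A B f" "g' \<in> cls B D g" for f' g'
    using that assms by (intro class_Cmp_cong) (simp_all add: class_mem_iff)
  \<comment> \<open>By \<open>cong\<close> the union is over a constant family; these memberships
    show that it is not an empty union.\<close>
  have mem: "f \<in> cls A B f" "g \<in> cls B D g"
    using assms by (simp_all add: class_mem_iff)
  have "Cmp Q A B D (cls A B f) (cls B D g) =
      (\<Union>f'\<in>cls A B f. \<Union>g'\<in>cls B D g. cls A D (Cmp C A B D f' g'))"
    by (simp add: quotient_cat_def)
  also have "\<dots> = (\<Union>f'\<in>cls A B f. \<Union>g'\<in>cls B D g. cls A D (Cmp C A B D f g))"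
    by (intro SUP_cong refl cong)
  also have "\<dots> = cls A D (Cmp C A B D f g)"
    using mem by blast
  finally show ?thesis .
qed

section \<open>Kernels in the quotient category\<close>

text \<open>\<open>mono\<close> expresses that the class of \<open>k\<close> is left cancellable
  against zero. By additivity it suffices to apply it to the difference \<open>?w\<close> of two
  lifts.\<close>

lemma quotient_lift_unique:
  assumes obj: "T \<in> Obj C" "K \<in> Obj C" "A \<in> Obj C"
    and k: "k \<in> Hom C K A"
    and mono: "\<And>v. \<lbrakk>v \<in> Hom C T K; Cmp C T K A v k \<in> I T A\<rbrakk> \<Longrightarrow> v \<in> I T K"
    and u: "u \<in> Hom C T K"
    and V: "V \<in> Hom Q T K" "Cmp Q T K A V (cls K A k) = cls T A (Cmp C T K A u k)"
  shows "V = cls T K u"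
proof -
  obtain v where v: "v \<in> Hom C T K" "V = cls T K v"
    using V(1) by (auto simp: Hom_quotient)
  let ?w = "Plus C T K v (inv\<^bsub>hom_group C T K\<^esub> u)"
  have "cls T A (Cmp C T K A v k) = cls T A (Cmp C T K A u k)"
    using V(2) v obj k by (simp add: Cmp_class)
  then have "Cmp C T K A ?w k \<in> I T A"
    using v u obj k by (simp add: class_eq_iff Cmp_in Cmp_Plus_left Cmp_inv_left inv_hom_closed)
  moreover have "?w \<in> Hom C T K"
    using monoid.m_closed[OF group.is_monoid[OF hom_is_group[OF obj(1,2)]], of v] v u obj
    by (simp add: inv_hom_closed)
  ultimately show ?thesis
    using mono v u obj by (simp add: class_eq_iff)
qed

text \<open>A kernel criterion on representatives: a weak kernel modulo the ideal together with
  \<open>mono\<close> gives a kernel. Although \<open>u\<close> acts on representatives, uniqueness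
  makes the class of \<open>u T t\<close> depend only on the class of \<open>t\<close>.\<close>

lemma
  assumes obj: "A \<in> Obj C" "B \<in> Obj C" "K \<in> Obj C"
    and hom: "f \<in> Hom C A B" "k \<in> Hom C K A"
    and comp: "Cmp C K A B k f \<in> I K B"
    and mono: "\<And>T v. \<lbrakk>T \<in> Obj C; v \<in> Hom C T K; Cmp C T K A v k \<in> I T A\<rbrakk> \<Longrightarrow> v \<in> I T K"
    and lift: "\<And>T t. \<lbrakk>T \<in> Obj C; t \<in> Hom C T A; Cmp C T A B t f \<in> I T B\<rbrakk>
      \<Longrightarrow> u T t \<in> Hom C T K \<and> Cmp C T K A (u T t) k = t"
  shows is_kernel_quotientI: "is_kernel Q A B (cls A B f) K (cls K A k)"
    and kernel_lift_quotient: "\<lbrakk>T \<in> Obj C; t \<in> Hom C T A; Cmp C T A B t f \<in> I T B\<rbrakk>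
      \<Longrightarrow> kernel_lift Q A K (cls K A k) T (cls T A t) = cls T K (u T t)"
proof -
  have ex: "cls T K (u T t) \<in> Hom Q T K \<and> Cmp Q T K A (cls T K (u T t)) (cls K A k) = cls T A t"
    and uniq: "\<And>V. V \<in> Hom Q T K \<and> Cmp Q T K A V (cls K A k) = cls T A t \<Longrightarrow> V = cls T K (u T t)"
    if T: "T \<in> Obj C" "t \<in> Hom C T A" "Cmp C T A B t f \<in> I T B" for T t
    using lift[OF T] T obj hom quotient_lift_unique[of T K A k "u T t", OF _ _ _ _ mono]
    by (auto simp: Cmp_class Hom_quotient)
  show "kernel_lift Q A K (cls K A k) T (cls T A t) = cls T K (u T t)"
    if "T \<in> Obj C" "t \<in> Hom C T A" "Cmp C T A B t f \<in> I T B"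
    unfolding kernel_lift_def using ex[OF that] uniq[OF that] by (rule the_equality)
  have "\<exists>!V. V \<in> Hom Q T K \<and> Cmp Q T K A V (cls K A k) = F"
    if T: "T \<in> Obj C" and F: "F \<in> Hom Q T A" "Cmp Q T A B F (cls A B f) = Zm Q T B" for T F
  proof -
    \<comment> \<open>Vanishing of a composite of classes can be tested on any one representative,
      so an arbitrary choice of \<open>t\<close> suffices.\<close>
    obtain t where t: "t \<in> Hom C T A" "F = cls T A t"
      using F(1) by (auto simp: Hom_quotient)
    have "Cmp C T A B t f \<in> I T B"
      using F(2) t T obj hom by (simp add: Cmp_class class_eq_Zm_iff Cmp_in)
    from ex[OF T t(1) this] uniq[OF T t(1) this] show ?thesis
      unfolding t(2) by (rule ex1I)
  qed
  then show "is_kernel Q A B (cls A B f) K (cls K A k)"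
    using obj hom comp
    by (auto simp: is_kernel_def Cmp_class class_eq_Zm_iff Cmp_in) (auto simp: Hom_quotient)
qed

end

subsection \<open>Syzygies\<close>

text \<open>Fixing the source \<open>S\<close> places the syzygies inside a single hom-group, where
  one can ask for a subgroup.\<close>

definition syzygies :: "('o, 'm, 'z) cat_scheme \<Rightarrow> ('o, 'm) cospan \<Rightarrow> 'o \<Rightarrow> 'm set" where
  "syzygies C X S = {\<sigma> \<in> Hom C S (lsrc X). \<exists>\<omega> \<in> Hom C S (rsrc X).
     Cmp C S (lsrc X) (apex X) \<sigma> (lleg X) = Cmp C S (rsrc X) (apex X) \<omega> (rleg X)}"

lemma Obj_Syz: "(S, \<sigma>) \<in> Obj (Syz C X) \<longleftrightarrow> S \<in> Obj C \<and> \<sigma> \<in> syzygies C X S"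
  by (auto simp: Syz_def full_subcat_def slice_def syzygies_def)

lemma Hom_Aux: "\<alpha> \<in> Hom (Aux C) X Y \<longleftrightarrow> \<alpha> \<in> Hom C (lsrc X) (lsrc Y) \<and>
    (\<forall>S \<in> Obj C. \<forall>\<sigma> \<in> syzygies C X S. Cmp C S (lsrc X) (lsrc Y) \<sigma> \<alpha> \<in> syzygies C Y S)"
  by (auto simp: Aux_def Obj_Syz)

lemma Hom_AuxD: "\<alpha> \<in> Hom (Aux C) X Y \<Longrightarrow> \<alpha> \<in> Hom C (lsrc X) (lsrc Y)"
  by (simp add: Hom_Aux)

lemma Aux_simps [simp]:
  "Obj (Aux C) = cospans C"
  "Idm (Aux C) X = Idm C (lsrc X)"
  "Cmp (Aux C) X Y Z = Cmp C (lsrc X) (lsrc Y) (lsrc Z)"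
  "Zm (Aux C) X Y = Zm C (lsrc X) (lsrc Y)"
  "Plus (Aux C) X Y = Plus C (lsrc X) (lsrc Y)"
  by (simp_all add: Aux_def)

lemma cospansD:
  assumes "X \<in> cospans C"
  shows "lsrc X \<in> Obj C" "apex X \<in> Obj C" "rsrc X \<in> Obj C"
    "lleg X \<in> Hom C (lsrc X) (apex X)" "rleg X \<in> Hom C (rsrc X) (apex X)"
  using assms by (auto simp: cospans_def)

lemma syzygies_Hom: "\<sigma> \<in> syzygies C X S \<Longrightarrow> \<sigma> \<in> Hom C S (lsrc X)"
  by (simp add: syzygies_def)

text \<open>The morphism \<open>\<zeta>\<close> in the definition of the ideal is exactly a syzygy
  witness for \<alpha>.\<close>

lemma Aux_ideal_iff:
  "\<alpha> \<in> Aux_ideal C X Y \<longleftrightarrow> \<alpha> \<in> Hom (Aux C) X Y \<and> \<alpha> \<in> syzygies C Y (lsrc X)"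
  by (auto simp: Aux_ideal_def syzygies_def Hom_Aux)

context category
begin

text \<open>Precomposing a witness of \<sigma> with \<open>f\<close> gives a witness of the
  composite.\<close>

lemma syzygies_Cmp_left:
  assumes X: "X \<in> cospans C" and "S \<in> Obj C" "T \<in> Obj C" "f \<in> Hom C S T" "\<sigma> \<in> syzygies C X T"
  shows "Cmp C S T (lsrc X) f \<sigma> \<in> syzygies C X S"
proof -
  note X = cospansD[OF X]
  obtain \<omega> where \<omega>: "\<omega> \<in> Hom C T (rsrc X)"
    "Cmp C T (lsrc X) (apex X) \<sigma> (lleg X) = Cmp C T (rsrc X) (apex X) \<omega> (rleg X)"
    and \<sigma>: "\<sigma> \<in> Hom C T (lsrc X)"
    using assms(5) by (auto simp: syzygies_def)
  then show ?thesis
    using assms X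
    by (auto simp: syzygies_def Cmp_in Cmp_assoc intro!: bexI[of _ "Cmp C S T (rsrc X) f \<omega>"])
qed

end

subsection \<open>The ideal of the auxiliary category\<close>

context preadditive_category
begin

text \<open>Composition with either leg is additive, so zero, negatives and sums of witnesses are
  again witnesses.\<close>

lemma subgroup_syzygies:
  assumes X: "X \<in> cospans C" and S: "S \<in> Obj C"
  shows "subgroup (syzygies C X S) (hom_group C S (lsrc X))"
proof -
  note X = cospansD[OF X]
  interpret G: group "hom_group C S (lsrc X)" using S X by (simp add: hom_is_group)
  interpret R: group "hom_group C S (rsrc X)" using S X by (simp add: hom_is_group)
  show ?thesis
  proof (rule G.subgroupI)
    show "syzygies C X S \<subseteq> carrier (hom_group C S (lsrc X))"
      by (auto simp: syzygies_def)
    have "Zm C S (lsrc X) \<in> syzygies C X S"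
      using S X G.one_closed R.one_closed
      by (auto simp: syzygies_def Cmp_Zm_left intro!: bexI[of _ "Zm C S (rsrc X)"])
    then show "syzygies C X S \<noteq> {}" by blast
  next
    fix a assume "a \<in> syzygies C X S"
    then obtain \<omega> where "a \<in> Hom C S (lsrc X)" "\<omega> \<in> Hom C S (rsrc X)"
      "Cmp C S (lsrc X) (apex X) a (lleg X) = Cmp C S (rsrc X) (apex X) \<omega> (rleg X)"
      by (auto simp: syzygies_def)
    then show "inv\<^bsub>hom_group C S (lsrc X)\<^esub> a \<in> syzygies C X S"
      using S X by (auto simp: syzygies_def Cmp_inv_left inv_hom_closed
        intro!: bexI[of _ "inv\<^bsub>hom_group C S (rsrc X)\<^esub> \<omega>"])
  next
    fix a b assume "a \<in> syzygies C X S" "b \<in> syzygies C X S"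
    then show "a \<otimes>\<^bsub>hom_group C S (lsrc X)\<^esub> b \<in> syzygies C X S"
      using S X G.m_closed R.m_closed
      by (clarsimp simp: syzygies_def) (metis Cmp_Plus_left)
  qed
qed

text \<open>For each syzygy \<sigma> of \<open>X\<close>, composing with \<sigma> on the left is
  additive in \<alpha>, and the syzygies of \<open>Y\<close> form a subgroup.\<close>

lemma subgroup_Hom_Aux:
  assumes X: "X \<in> cospans C" and Y: "Y \<in> cospans C"
  shows "subgroup (Hom (Aux C) X Y) (hom_group C (lsrc X) (lsrc Y))"
proof -
  note X = cospansD[OF X] and Y' = cospansD[OF Y]
  interpret G: group "hom_group C (lsrc X) (lsrc Y)" using X Y' by (simp add: hom_is_group)
  note sub = subgroup_syzygies[OF Y]
  show ?thesis
  proof (rule G.subgroupI)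
    show "Hom (Aux C) X Y \<subseteq> carrier (hom_group C (lsrc X) (lsrc Y))"
      by (auto simp: Hom_Aux)
    have "Zm C (lsrc X) (lsrc Y) \<in> Hom (Aux C) X Y"
      using X Y' G.one_closed subgroup.one_closed[OF sub]
      by (auto simp: Hom_Aux Cmp_Zm_right syzygies_Hom)
    then show "Hom (Aux C) X Y \<noteq> {}" by blast
  next
    fix a assume "a \<in> Hom (Aux C) X Y"
    then show "inv\<^bsub>hom_group C (lsrc X) (lsrc Y)\<^esub> a \<in> Hom (Aux C) X Y"
      using X Y' subgroup.m_inv_closed[OF sub]
      by (auto simp: Hom_Aux Cmp_inv_right inv_hom_closed syzygies_Hom)
  next
    fix a b assume "a \<in> Hom (Aux C) X Y" "b \<in> Hom (Aux C) X Y"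
    then show "a \<otimes>\<^bsub>hom_group C (lsrc X) (lsrc Y)\<^esub> b \<in> Hom (Aux C) X Y"
      using X Y' G.m_closed subgroup.m_closed[OF sub]
      by (auto simp: Hom_Aux Cmp_Plus_right syzygies_Hom)
  qed
qed

text \<open>Puts the hom-groups of \<open>Aux\<close> into the shape in which HOL-Algebra states
  results on subgroups.\<close>

lemma hom_group_Aux:
  "hom_group (Aux C) X Y = (hom_group C (lsrc X) (lsrc Y))\<lparr>carrier := Hom (Aux C) X Y\<rparr>"
  by (simp add: hom_group_def)

text \<open>All equations are inherited from \<open>C\<close>. What remains is closure of the
  hom-sets: under addition they are subgroups, and composites preserve syzygies by
  associativity.\<close>

lemma preadditive_category_Aux: "preadditive_category (Aux C)"
proof (intro preadditive_category.intro category.intro preadditive_category_axioms.intro)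
  fix X Y assume XY: "X \<in> Obj (Aux C)" "Y \<in> Obj (Aux C)"
  then interpret G: comm_group "hom_group C (lsrc X) (lsrc Y)"
    by (simp add: hom_comm_group cospansD)
  have sub: "subgroup (Hom (Aux C) X Y) (hom_group C (lsrc X) (lsrc Y))"
    using XY by (simp add: subgroup_Hom_Aux)
  show "comm_group (hom_group (Aux C) X Y)"
    unfolding hom_group_Aux
    using G.submonoid_is_comm_monoid[OF subgroup.subgroup_is_submonoid[OF sub]]
      G.subgroup_imp_group[OF sub]
    by (rule comm_group.intro)
next
  fix X Y Z f g
  assume "X \<in> Obj (Aux C)" "Y \<in> Obj (Aux C)" "Z \<in> Obj (Aux C)"
    "f \<in> Hom (Aux C) X Y" "g \<in> Hom (Aux C) Y Z"
  then show "Cmp (Aux C) X Y Z f g \<in> Hom (Aux C) X Z"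
    by (auto simp: Hom_Aux Cmp_in cospansD syzygies_Hom Cmp_assoc[symmetric])
next
  fix X assume "X \<in> Obj (Aux C)"
  then show "Idm (Aux C) X \<in> Hom (Aux C) X X"
    by (simp add: Hom_Aux Idm_in Idm_right cospansD syzygies_Hom)
qed (simp_all add: Hom_AuxD Idm_left Idm_right Cmp_assoc Cmp_Plus_left Cmp_Plus_right cospansD)

text \<open>Each ideal component is an intersection of two subgroups. Closure under composition on
  the left is \<open>syzygies_Cmp_left\<close>; on the right it is the well-definedness property of
  \<open>g\<close>, applied to the syzygy \<open>f\<close>.\<close>

lemma preadditive_ideal_Aux: "preadditive_ideal (Aux C) (Aux_ideal C)"
proof (intro preadditive_ideal.intro preadditive_ideal_axioms.intro preadditive_category_Aux)
  fix X Y assume XY: "X \<in> Obj (Aux C)" "Y \<in> Obj (Aux C)"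
  then interpret G: group "hom_group C (lsrc X) (lsrc Y)"
    by (simp add: hom_is_group cospansD)
  have "Aux_ideal C X Y = Hom (Aux C) X Y \<inter> syzygies C Y (lsrc X)"
    by (auto simp: Aux_ideal_iff)
  moreover have "subgroup \<dots> (hom_group C (lsrc X) (lsrc Y))"
    using XY by (intro G.subgroups_Inter_pair subgroup_Hom_Aux subgroup_syzygies)
      (simp_all add: cospansD)
  ultimately show "subgroup (Aux_ideal C X Y) (hom_group (Aux C) X Y)"
    unfolding hom_group_Aux using XY by (auto intro!: G.subgroup_incl subgroup_Hom_Aux)
next
  interpret Aux: preadditive_category "Aux C" by (rule preadditive_category_Aux)
  fix X Y Z f g
  assume obj: "X \<in> Obj (Aux C)" "Y \<in> Obj (Aux C)" "Z \<in> Obj (Aux C)"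
  show "Cmp (Aux C) X Y Z f g \<in> Aux_ideal C X Z"
    if "f \<in> Hom (Aux C) X Y" "g \<in> Aux_ideal C Y Z"
    using that obj Aux.Cmp_in[OF obj, of f g]
    by (auto simp: Aux_ideal_iff cospansD syzygies_Cmp_left Hom_Aux)
  show "Cmp (Aux C) X Y Z f g \<in> Aux_ideal C X Z"
    if "f \<in> Aux_ideal C X Y" "g \<in> Hom (Aux C) Y Z"
    using that obj Aux.Cmp_in[OF obj, of f g]
    by (auto simp: Aux_ideal_iff cospansD Hom_Aux)
qed

text \<open>By associativity both sides have the same witnesses. This serves both for the source
  cospan of the kernel embedding and for the cospan whose biased weak pullback is taken.\<close>

lemma syzygies_pullback_leg:
  assumes A: "A \<in> cospans C" and "P \<in> Obj C" "S \<in> Obj C" "\<pi> \<in> Hom C P (lsrc A)" "\<sigma> \<in> Hom C S P"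
  shows "\<sigma> \<in> syzygies C \<lparr>lsrc = P, apex = apex A, rsrc = rsrc A,
        lleg = Cmp C P (lsrc A) (apex A) \<pi> (lleg A), rleg = rleg A\<rparr> S
    \<longleftrightarrow> Cmp C S P (lsrc A) \<sigma> \<pi> \<in> syzygies C A S"
  using assms cospansD[OF A] by (auto simp: syzygies_def Cmp_in Cmp_assoc)

end

section \<open>The kernel of a morphism of the quotient category\<close>

theorem mainTheorem10:
  fixes P :: "('o, 'm) abcat"
    and bwp :: "('o, 'm) cospan \<Rightarrow> ('o, 'm) bw_pullback"
    and A B K :: "('o, 'm) cospan"
    and \<alpha> \<pi> :: 'm
    and W :: "('o, 'm) bw_pullback"
  assumes "additive_category P"
    and "has_biased_weak_pullbacks P bwp"
    and "A \<in> Obj (Aux P)" and "B \<in> Obj (Aux P)"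
    and "\<alpha> \<in> Hom (Aux P) A B"
    and "W = bwp \<lparr>lsrc = lsrc A, apex = apex B, rsrc = rsrc B,
           lleg = Cmp P (lsrc A) (lsrc B) (apex B) \<alpha> (lleg B), rleg = rleg B\<rparr>"
    and "\<pi> = bw_proj W"
    and "K = \<lparr>lsrc = bw_obj W, apex = apex A, rsrc = rsrc A,
           lleg = Cmp P (bw_obj W) (lsrc A) (apex A) \<pi> (lleg A), rleg = rleg A\<rparr>"
  shows "K \<in> Obj (QCat P) \<and>
    \<pi> \<in> Hom (Aux P) K A \<and>
    QClass P K A \<pi> \<in> Hom (QCat P) K A \<and>
    is_kernel (QCat P) A B (QClass P A B \<alpha>) K (QClass P K A \<pi>) \<and>
    (\<forall>T \<in> Obj (Aux P). \<forall>\<tau> \<in> Hom (Aux P) T A.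
       Cmp (QCat P) T A B (QClass P T A \<tau>) (QClass P A B \<alpha>) = Zm (QCat P) T B \<longrightarrow>
       bw_univ W (lsrc T) \<tau> \<in> Hom (Aux P) T K \<and>
       QClass P T K (bw_univ W (lsrc T) \<tau>) =
         kernel_lift (QCat P) A K (QClass P K A \<pi>) T (QClass P T A \<tau>))"
  proof -
  interpret additive_category P by (rule assms(1))
  interpret pa: preadditive_ideal "Aux P" "Aux_ideal P" by (rule preadditive_ideal_Aux)
  note AB = assms(3,4)[simplified]
  note A = cospansD[OF AB(1)] and B = cospansD[OF AB(2)]
  have \<alpha>: "\<alpha> \<in> Hom P (lsrc A) (lsrc B)"
    using assms(5) by (simp add: Hom_Aux)
  define X where "X = \<lparr>lsrc = lsrc A, apex = apex B, rsrc = rsrc B,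
    lleg = Cmp P (lsrc A) (lsrc B) (apex B) \<alpha> (lleg B), rleg = rleg B\<rparr>"
  have "X \<in> cospans P"
    using A B \<alpha> by (simp add: X_def cospans_def Cmp_in)
  then have "biased_weak_pullback P X W"
    using assms(2,6) by (simp add: has_biased_weak_pullbacks_def X_def)
  \<comment> \<open>In terms of syzygies, the projection is a syzygy of \<open>X\<close>, and the
    universal operation applies to every syzygy of \<open>X\<close>.\<close>
  then have Pobj: "bw_obj W \<in> Obj P"
    and \<pi>_syz: "\<pi> \<in> syzygies P X (bw_obj W)"
    and univ: "\<And>T \<tau>. \<lbrakk>T \<in> Obj P; \<tau> \<in> syzygies P X T\<rbrakk>
      \<Longrightarrow> bw_univ W T \<tau> \<in> Hom P T (bw_obj W) \<and>
          Cmp P T (bw_obj W) (lsrc A) (bw_univ W T \<tau>) \<pi> = \<tau>"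
    unfolding biased_weak_pullback_def assms(7) syzygies_def
    by (auto simp: X_def eq_commute)
  have \<pi>: "\<pi> \<in> Hom P (bw_obj W) (lsrc A)"
    using \<pi>_syz by (simp add: syzygies_def X_def)
  have K: "K \<in> cospans P"
    using Pobj A \<pi> by (simp add: assms(8) cospans_def Cmp_in)
  have lsrc_K [simp]: "lsrc K = bw_obj W"
    by (simp add: assms(8))
  have syz_K: "\<sigma> \<in> syzygies P K S \<longleftrightarrow> Cmp P S (bw_obj W) (lsrc A) \<sigma> \<pi> \<in> syzygies P A S"
    if "S \<in> Obj P" "\<sigma> \<in> Hom P S (bw_obj W)" for S \<sigma>
    unfolding assms(8) using that AB Pobj \<pi> by (intro syzygies_pullback_leg)
  have syz_X: "\<sigma> \<in> syzygies P X S \<longleftrightarrow> Cmp P S (lsrc A) (lsrc B) \<sigma> \<alpha> \<in> syzygies P B S"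
    if "S \<in> Obj P" "\<sigma> \<in> Hom P S (lsrc A)" for S \<sigma>
    unfolding X_def using that AB A \<alpha> by (intro syzygies_pullback_leg)
  \<comment> \<open>The forward direction of \<open>syz_K\<close> is the well-definedness property
    of \<pi>.\<close>
  have \<pi>_Aux: "\<pi> \<in> Hom (Aux P) K A"
    using \<pi> syz_K syzygies_Hom[of _ P K] by (auto simp: Hom_Aux)
  \<comment> \<open>Since \<pi> is a syzygy of \<open>X\<close>, \<open>syz_X\<close> makes its
    composite with \<alpha> a syzygy of \<open>B\<close>.\<close>
  have comp: "Cmp (Aux P) K A B \<pi> \<alpha> \<in> Aux_ideal P K B"
    using AB K \<pi>_Aux assms(5) \<pi> \<pi>_syz Pobj syz_X pa.Cmp_in[of K A B \<pi> \<alpha>]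
    by (simp add: Aux_ideal_iff)
  \<comment> \<open>The backward direction of \<open>syz_K\<close>, with \<open>v\<close> itself as
    the candidate syzygy.\<close>
  have mono: "v \<in> Aux_ideal P T K"
    if "T \<in> Obj (Aux P)" "v \<in> Hom (Aux P) T K" "Cmp (Aux P) T K A v \<pi> \<in> Aux_ideal P T A" for T v
    using that syz_K by (auto simp: Aux_ideal_iff Hom_Aux cospansD)
  have lift: "bw_univ W (lsrc T) \<tau> \<in> Hom (Aux P) T K \<and>
      Cmp (Aux P) T K A (bw_univ W (lsrc T) \<tau>) \<pi> = \<tau>"
    if T: "T \<in> Obj (Aux P)" and \<tau>: "\<tau> \<in> Hom (Aux P) T A"
      and "Cmp (Aux P) T A B \<tau> \<alpha> \<in> Aux_ideal P T B" for T \<tau>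
  proof -
    have T': "lsrc T \<in> Obj P" using T by (simp add: cospansD)
    have "\<tau> \<in> syzygies P X (lsrc T)"
      using that T' syz_X by (simp add: Aux_ideal_iff Hom_Aux)
    note u = univ[OF T' this]
    \<comment> \<open>By \<open>syz_K\<close> this may be checked after composing with \<pi>, where
      the lift collapses to \<tau>; and \<tau> preserves syzygies.\<close>
    have "Cmp P S (lsrc T) (bw_obj W) \<sigma> (bw_univ W (lsrc T) \<tau>) \<in> syzygies P K S"
      if S: "S \<in> Obj P" and \<sigma>: "\<sigma> \<in> syzygies P T S" for S \<sigma>
    proof -
      note \<sigma>' = syzygies_Hom[OF \<sigma>]
      have "Cmp P S (lsrc T) (lsrc A) \<sigma> \<tau> \<in> syzygies P A S"
        using \<tau> S \<sigma> by (simp add: Hom_Aux)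
      then show ?thesis
        using u S \<sigma>' T' Pobj A \<pi> by (simp add: syz_K Cmp_in Cmp_assoc)
    qed
    then show ?thesis
      using u by (simp add: Hom_Aux)
  qed
  \<comment> \<open>The criterion quantifies over cospans \<open>T\<close>, whereas the universal
    operation expects an object of \<open>P\<close>; hence the passage to
    \<open>lsrc T\<close>.\<close>
  note kernel = pa.is_kernel_quotientI[where u = "\<lambda>T. bw_univ W (lsrc T)",
      OF assms(3,4) _ assms(5) \<pi>_Aux comp mono lift]
    and kernel_lift = pa.kernel_lift_quotient[where u = "\<lambda>T. bw_univ W (lsrc T)",
      OF assms(3,4) _ assms(5) \<pi>_Aux comp mono lift]
  show ?thesis
    unfolding QCat_def QClass_def
  proof (intro conjI ballI impI)
    show "K \<in> Obj pa.Q" "\<pi> \<in> Hom (Aux P) K A" "pa.cls K A \<pi> \<in> Hom pa.Q K A"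
      using K \<pi>_Aux by (simp_all add: pa.Hom_quotient)
    show "is_kernel pa.Q A B (pa.cls A B \<alpha>) K (pa.cls K A \<pi>)"
      using K by (intro kernel) simp_all
  next
    fix T \<tau> assume T: "T \<in> Obj (Aux P)" "\<tau> \<in> Hom (Aux P) T A"
      and "Cmp pa.Q T A B (pa.cls T A \<tau>) (pa.cls A B \<alpha>) = Zm pa.Q T B"
    then have zero: "Cmp (Aux P) T A B \<tau> \<alpha> \<in> Aux_ideal P T B"
      using assms(3-5) pa.Cmp_in[of T A B \<tau> \<alpha>] by (simp add: pa.Cmp_class pa.class_eq_Zm_iff)
    show "bw_univ W (lsrc T) \<tau> \<in> Hom (Aux P) T K"
      using lift[OF T zero] by blast
    show "pa.cls T K (bw_univ W (lsrc T) \<tau>) = kernel_lift pa.Q A K (pa.cls K A \<pi>) T (pa.cls T A \<tau>)"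
      using K T zero by (intro kernel_lift[symmetric]) simp_all
  qed
qed

end
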